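(* Let $m\equiv 1\pmod 4$ and let $M$ be a maximum induced matching of the grid $G_{3,m}$. Suppose that for some $j$ with $1\le j$ and $j+8\le m$, both the edge joining $u_1v_j$ and $u_2v_j$ and the edge joining $u_1v_{j+8}$ and $u_2v_{j+8}$ belong to $M$. Then: (a) at least four of the vertices $u_1v_{j+1},u_1v_{j+2},\dots,u_1v_{j+7}$ are saturated by $M$; (b) at most one of the vertices $u_2v_{j+1},u_2v_{j+2},\dots,u_2v_{j+7}$ is saturated by $M$; (c) at most five of the vertices $u_3v_{j},u_3v_{j+1},\dots,u_3v_{j+8}$ are saturated by $M$.
   Context: For integers $n,m\geq 2$, the grid $G_{n,m}$ is the Cartesian product of the path $P_n=u_1u_2\cdots u_n$ and the path $P_m=v_1v_2\cdots v_m$; its vertices are written $u_iv_j$ ($1\le i\le n$, $1\le j\le m$), and $u_iv_j$, $u_kv_l$ are adjacent iff either $i=k$ and $|j-l|=1$, or $j=l$ and $|i-k|=1$. An induced matching of a graph $G$ is a set $M$ of pairwise vertex-disjoint edges such that no edge of $G$ joins endpoints of two distinct edges of $M$; a maximum induced matching is one of largest possible size. A vertex is saturated by $M$ if it is an endpoint of an edge of $M$. *)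

theory Defs
  imports Main
begin

text \<open>
  A finite simple graph is given by its vertex set together with its edge set, edges being
  two-element sets of vertices.
\<close>

type_synonym 'a ugraph = "'a set \<times> 'a set set"

definition path_graph :: "nat \<Rightarrow> nat ugraph" where
  "path_graph n = ({1..n}, {{i, Suc i} | i. 1 \<le> i \<and> i < n})"

definition cartesian_product :: "'a ugraph \<Rightarrow> 'b ugraph \<Rightarrow> ('a \<times> 'b) ugraph" where
  "cartesian_product G H =
     (fst G \<times> fst H,
      {{(u, v), (u, v')} | u v v'. u \<in> fst G \<and> {v, v'} \<in> snd H} \<union>
      {{(u, v), (u', v)} | u u' v. {u, u'} \<in> snd G \<and> v \<in> fst H})"

text \<open>The vertex written \<open>u\<^sub>i v\<^sub>j\<close> in the source is the pair \<open>(i, j)\<close>, indices starting at 1.\<close>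

definition grid :: "nat \<Rightarrow> nat \<Rightarrow> (nat \<times> nat) ugraph" where
  "grid n m = cartesian_product (path_graph n) (path_graph m)"

definition induced_matching :: "'a ugraph \<Rightarrow> 'a set set \<Rightarrow> bool" where
  "induced_matching G M \<longleftrightarrow>
     M \<subseteq> snd G \<and>
     (\<forall>e\<in>M. \<forall>f\<in>M. e \<noteq> f \<longrightarrow> e \<inter> f = {}) \<and>
     (\<forall>e\<in>M. \<forall>f\<in>M. e \<noteq> f \<longrightarrow> \<not> (\<exists>x\<in>e. \<exists>y\<in>f. {x, y} \<in> snd G))"

text \<open>The finiteness conditions only guard against \<open>card\<close> being 0 on infinite sets.\<close>

definition maximum_induced_matching :: "'a ugraph \<Rightarrow> 'a set set \<Rightarrow> bool" where
  "maximum_induced_matching G M \<longleftrightarrow>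
     induced_matching G M \<and> finite M \<and>
     (\<forall>N. induced_matching G N \<longrightarrow> finite N \<and> card N \<le> card M)"

definition saturated :: "'a set set \<Rightarrow> 'a \<Rightarrow> bool" where
  "saturated M x \<longleftrightarrow> (\<exists>e\<in>M. x \<in> e)"

lemma path_graph_edge_iff:
  "{i, k} \<in> snd (path_graph n) \<longleftrightarrow>
     i \<in> {1..n} \<and> k \<in> {1..n} \<and> \<bar>int i - int k\<bar> = 1"
proof
  assume "{i, k} \<in> snd (path_graph n)"
  then show "i \<in> {1..n} \<and> k \<in> {1..n} \<and> \<bar>int i - int k\<bar> = 1"
    by (auto simp: path_graph_def doubleton_eq_iff)
next
  assume *: "i \<in> {1..n} \<and> k \<in> {1..n} \<and> \<bar>int i - int k\<bar> = 1"
  then have "k = Suc i \<or> i = Suc k" by auto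
  with * show "{i, k} \<in> snd (path_graph n)"
    by (auto simp: path_graph_def doubleton_eq_iff)
qed

lemma grid_verts: "fst (grid n m) = {1..n} \<times> {1..m}"
  by (simp add: grid_def cartesian_product_def path_graph_def)

lemma grid_edge_iff:
  "{(i, j), (k, l)} \<in> snd (grid n m) \<longleftrightarrow>
     (i, j) \<in> fst (grid n m) \<and> (k, l) \<in> fst (grid n m) \<and>
     (i = k \<and> \<bar>int j - int l\<bar> = 1 \<or> j = l \<and> \<bar>int i - int k\<bar> = 1)"
proof -
  have v: "fst (path_graph p) = {1..p}" for p by (simp add: path_graph_def)
  have "{(i, j), (k, l)} \<in> snd (grid n m) \<longleftrightarrow>
     (i = k \<and> i \<in> {1..n} \<and> {j, l} \<in> snd (path_graph m)) \<or>
     (j = l \<and> j \<in> {1..m} \<and> {i, k} \<in> snd (path_graph n))"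
    (is "?L \<longleftrightarrow> ?R")
  proof
    assume ?L
    then show ?R
      unfolding grid_def cartesian_product_def v snd_conv
      by (auto simp: doubleton_eq_iff insert_commute)
  next
    assume ?R
    then show ?L
      unfolding grid_def cartesian_product_def v snd_conv by blast
  qed
  then show ?thesis
    unfolding path_graph_edge_iff grid_verts by auto
qed

end

theory Submission
  imports Defs
begin

text \<open>
  Read a matching column by column. A potential on pairs of consecutive columns shows that a
  stretch of columns holds at most \<open>3/2\<close> saturated vertices per column, up to a boundary term.
  For \<open>m = 4 k + 1\<close> an explicit periodic matching has \<open>3 k + 1\<close> edges, so a maximum one
  exceeds the rate \<open>3/2\<close>. The columns before an edge \<open>u\<^sub>1v\<^sub>j u\<^sub>2v\<^sub>j\<close>, and by reflection those after
  \<open>u\<^sub>1v\<^bsub>j+8\<^esub> u\<^sub>2v\<^bsub>j+8\<^esub>\<close>, cannot contribute to the surplus. Hence the potential inequality is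
  tight at each column of the window, and this leaves a single possibility for the window.
\<close>

section \<open>Columns and their potential\<close>

type_synonym column = "bool \<times> bool \<times> bool"

text \<open>Local form of the condition that each saturated vertex has exactly one saturated
  neighbour, imposed on the middle column only.\<close>

fun valid :: "column \<Rightarrow> column \<Rightarrow> column \<Rightarrow> bool" where
  "valid (a1, a2, a3) (b1, b2, b3) (c1, c2, c3) \<longleftrightarrow>
     (b1 \<longrightarrow> of_bool a1 + of_bool c1 + of_bool b2 = (1::nat)) \<and>
     (b2 \<longrightarrow> of_bool a2 + of_bool c2 + of_bool b1 + of_bool b3 = (1::nat)) \<and>
     (b3 \<longrightarrow> of_bool a3 + of_bool c3 + of_bool b2 = (1::nat))"

fun weight :: "column \<Rightarrow> int" where
  "weight (b1, b2, b3) = of_bool b1 + of_bool b2 + of_bool b3"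

text \<open>Doubled to stay in the integers: a stretch of columns beats the rate 3/2 exactly when
  its total excess is positive.\<close>

abbreviation excess :: "column \<Rightarrow> int" where
  "excess b \<equiv> 2 * weight b - 3"

text \<open>
  The largest total excess of columns \<open>1, \<dots>, n\<close> over all \<open>n\<close> and all valid sequences that start
  after an empty column and have \<open>a\<close>, \<open>b\<close> as columns \<open>n\<close>, \<open>n + 1\<close>; its values on pairs
  that no such sequence reaches are chosen to keep the next lemma true.
\<close>

fun potential :: "column \<Rightarrow> column \<Rightarrow> int" where
  "potential (a1, a2, a3) (b1, b2, b3) =
     (if a1 \<and> a2 \<and> \<not> a3 then of_bool (\<not> b1 \<and> \<not> b2)
      else if \<not> a1 \<and> a2 \<and> a3 then of_bool (\<not> b2 \<and> \<not> b3)
      else if a1 \<and> \<not> a2 \<and> a3 then (if b1 \<or> b3 then 1 else 2)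
      else of_bool (\<not> a1 \<and> a2 \<and> \<not> a3 \<and> b2))"

text \<open>A finite check. The quantifiers stay inside the statement so that \<open>simp\<close>
  can expand every column into all its Boolean values.\<close>

lemma excess_le_potential_diff [rule_format]:
  "\<forall>a b c. valid a b c \<longrightarrow> excess b \<le> potential b c - potential a b"
  by (simp add: all_bool_eq)

definition tight :: "column \<Rightarrow> column \<Rightarrow> column \<Rightarrow> bool" where
  "tight a b c \<longleftrightarrow> valid a b c \<and> excess b = potential b c - potential a b"

text \<open>A forced walk through the window. Two consecutive equalities are demanded since one may
  leave a choice: after \<open>(True, True, False)\<close> the empty column passes the first and
  fails the second.\<close>

lemma tight_steps [rule_format]:
  "\<forall>a b c. tight a (True, True, False) b \<longrightarrow> tight (True, True, False) b c \<longrightarrow>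
     b = (False, False, True)"
  "\<forall>b c. tight (True, True, False) (False, False, True) b \<longrightarrow> tight (False, False, True) b c \<longrightarrow>
     b = (True, False, True)"
  "\<forall>b c. tight (False, False, True) (True, False, True) b \<longrightarrow> tight (True, False, True) b c \<longrightarrow>
     b = (True, False, False)"
  "\<forall>b c. tight (True, False, True) (True, False, False) b \<longrightarrow> tight (True, False, False) b c \<longrightarrow>
     b = (False, True, True)"
  "\<forall>b c. tight (True, False, False) (False, True, True) b \<longrightarrow> tight (False, True, True) b c \<longrightarrow>
     b = (True, False, False)"
  "\<forall>b c. tight (False, True, True) (True, False, False) b \<longrightarrow> tight (True, False, False) b c \<longrightarrow>
     b = (True, False, True)"
  "\<forall>b c. tight (True, False, False) (True, False, True) b \<longrightarrow> tight (True, False, True) b c \<longrightarrow>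
     b = (False, False, True)"
  by (simp_all add: tight_def all_bool_eq)

section \<open>Excess of stretches of columns\<close>

lemma sum_excess_le:
  fixes s :: "nat \<Rightarrow> column"
  assumes "\<And>i. i \<in> {Suc a..b} \<Longrightarrow> valid (s (i - 1)) (s i) (s (i + 1))" and "a \<le> b"
  shows "(\<Sum>i\<in>{Suc a..b}. excess (s i))
    \<le> potential (s b) (s (Suc b)) - potential (s a) (s (Suc a))"
  using assms(2,1)
proof (induction b rule: dec_induct)
  case (step n)
  have "valid (s n) (s (Suc n)) (s (Suc (Suc n)))"
    using step.prems[of "Suc n"] step.hyps by simp
  from excess_le_potential_diff[OF this] step show ?case
    by simp
qed simp

lemma potential_nonneg: "potential a b \<ge> 0"
  by (cases a; cases b) simp

lemma potential_from_vertical: "potential (True, True, False) b \<le> 1"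
  by (cases b) simp

text \<open>Both ends of the vertical edge already have their neighbour, so the first two entries of
  \<open>a\<close> are false and no positive branch of \<open>potential\<close> applies.\<close>

lemma potential_before_vertical [rule_format]:
  "\<forall>a c. valid a (True, True, False) c \<longrightarrow> potential a (True, True, False) = 0"
  by (simp add: all_bool_eq)

text \<open>Unlike \<open>potential\<close>, \<open>valid\<close> has no direction, so bounds to the
  left of a column carry over to its right by reversal.\<close>

lemma valid_commute: "valid a b c \<longleftrightarrow> valid c b a"
proof -
  have "\<forall>a b c. valid a b c \<longleftrightarrow> valid c b a" by (simp add: all_bool_eq)
  then show ?thesis by blast
qed

text \<open>The potential is nonnegative at the start and 0 just before the vertical edge, so
  telescoping leaves nothing positive.\<close>

lemma sum_excess_before_vertical:
  fixes s :: "nat \<Rightarrow> column"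
  assumes valid: "\<And>i. i \<in> {1..j} \<Longrightarrow> valid (s (i - 1)) (s i) (s (i + 1))"
    and "1 \<le> j" and "s j = (True, True, False)"
  shows "(\<Sum>i\<in>{1..<j}. excess (s i)) \<le> 0"
proof -
  obtain j' where j: "j = Suc j'" using \<open>1 \<le> j\<close> by (cases j) auto
  have "(\<Sum>i\<in>{Suc 0..j'}. excess (s i))
    \<le> potential (s j') (s (Suc j')) - potential (s 0) (s (Suc 0))"
    by (rule sum_excess_le) (use valid j in auto)
  moreover have "potential (s j') (s (Suc j')) = 0"
    using valid[of j] assms(3) j potential_before_vertical by simp
  moreover have "{1..<j} = {Suc 0..j'}" using j by auto
  ultimately show ?thesis using potential_nonneg[of "s 0" "s (Suc 0)"] by simp
qed

lemma sum_excess_after_vertical: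
  fixes s :: "nat \<Rightarrow> column"
  assumes valid: "\<And>i. i \<in> {j..m} \<Longrightarrow> valid (s (i - 1)) (s i) (s (i + 1))"
    and "1 \<le> j" "j \<le> m" and "s j = (True, True, False)"
  shows "(\<Sum>i\<in>{Suc j..m}. excess (s i)) \<le> 0"
proof -
  \<comment> \<open>proof by reversal: replacing \<open>i\<close> by \<open>Suc m - i\<close> moves
    column \<open>m + 1\<close> to position 0 and column \<open>j\<close> to the end of the
    stretch.\<close>
  have "(\<Sum>i\<in>{1..<Suc m - j}. excess (s (Suc m - i))) \<le> 0"
  proof (rule sum_excess_before_vertical)
    fix i assume i: "i \<in> {1..Suc m - j}"
    then have "Suc m - i - 1 = Suc m - (i + 1)" "Suc m - i + 1 = Suc m - (i - 1)"
      using assms(2,3) by auto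
    moreover have "Suc m - i \<in> {j..m}" using i by auto
    ultimately show "valid (s (Suc m - (i - 1))) (s (Suc m - i)) (s (Suc m - (i + 1)))"
      using valid[of "Suc m - i"] by (subst valid_commute) simp
  qed (use assms in auto)
  also have "(\<Sum>i\<in>{1..<Suc m - j}. excess (s (Suc m - i))) = (\<Sum>i\<in>{Suc j..m}. excess (s i))"
    by (rule sum.reindex_bij_witness[of _ "\<lambda>i. Suc m - i" "\<lambda>i. Suc m - i"])
      (use assms(3) in auto)
  finally show ?thesis .
qed

lemma window_columns:
  fixes s :: "nat \<Rightarrow> column"
  assumes valid: "\<And>i. i \<in> {1..m} \<Longrightarrow> valid (s (i - 1)) (s i) (s (i + 1))"
    and j: "1 \<le> j" "j + 8 \<le> m"
    and ends: "s j = (True, True, False)" "s (j + 8) = (True, True, False)"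
    and pos: "(\<Sum>i\<in>{1..m}. excess (s i)) \<ge> 1"
  shows "s (j + 1) = (False, False, True)" "s (j + 2) = (True, False, True)"
    "s (j + 3) = (True, False, False)" "s (j + 4) = (False, True, True)"
    "s (j + 5) = (True, False, False)" "s (j + 6) = (True, False, True)"
    "s (j + 7) = (False, False, True)"
proof -
  define d where "d i = potential (s i) (s (i + 1)) - potential (s (i - 1)) (s i)" for i
  have "{1..m} = {1..<j} \<union> ({j..j + 8} \<union> {Suc (j + 8)..m})" using j by auto
  then have "(\<Sum>i\<in>{1..m}. excess (s i)) = (\<Sum>i\<in>{1..<j}. excess (s i)) +
     ((\<Sum>i\<in>{j..j + 8}. excess (s i)) + (\<Sum>i\<in>{Suc (j + 8)..m}. excess (s i)))"
    by (simp only:) (subst sum.union_disjoint; auto)+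
  moreover have "(\<Sum>i\<in>{1..<j}. excess (s i)) \<le> 0"
    by (rule sum_excess_before_vertical) (use assms in auto)
  moreover have "(\<Sum>i\<in>{Suc (j + 8)..m}. excess (s i)) \<le> 0"
    by (rule sum_excess_after_vertical) (use assms in auto)
  ultimately have lower: "(\<Sum>i\<in>{j..j + 8}. excess (s i)) \<ge> 1" using pos by linarith
  have le: "excess (s i) \<le> d i" if "i \<in> {j..j + 8}" for i
    unfolding d_def using valid[of i] that j by (intro excess_le_potential_diff) auto
  have "(\<Sum>i\<in>{j..j + 8}. d i) = potential (s (j + 8)) (s (j + 9)) - potential (s (j - 1)) (s j)"
    using j(1) by (simp add: d_def sum.atLeast_Suc_atMost numeral_eq_Suc)
  also have "\<dots> \<le> 1"
    using potential_from_vertical[of "s (j + 9)"] potential_nonneg[of "s (j - 1)" "s j"] ends(2)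
    by simp
  \<comment> \<open>A surplus of at least 1 meets a potential gain of at most 1: nine nonnegative
    slacks have sum at most 0, so each vanishes.\<close>
  finally have "(\<Sum>i\<in>{j..j + 8}. d i - excess (s i)) \<le> 0"
    using lower by (simp only: sum_subtractf)
  moreover have nonneg: "0 \<le> d i - excess (s i)" if "i \<in> {j..j + 8}" for i
    using le that by simp
  ultimately have "(\<Sum>i\<in>{j..j + 8}. d i - excess (s i)) = 0"
    by (intro antisym sum_nonneg)
  then have "\<forall>i\<in>{j..j + 8}. d i - excess (s i) = 0"
    using nonneg by (subst (asm) sum_nonneg_eq_0_iff) auto
  then have tight: "tight (s (i - 1)) (s i) (s (i + 1))" if "i \<in> {j..j + 8}" for i
    using that valid[of i] j by (auto simp: tight_def d_def)
  have t: "tight (s (j + k)) (s (j + Suc k)) (s (j + Suc (Suc k)))" if "k < 8" for k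
    using tight[of "j + Suc k"] that by simp
  note ts = t[of 0] t[of 1] t[of 2] t[of 3] t[of 4] t[of 5] t[of 6] t[of 7]
  \<comment> \<open>Indices are brought to \<open>Suc\<close> form so that these facts match the
    later goals syntactically.\<close>
  note ts = ts[simplified numeral_eq_Suc, simplified]
  show c1: "s (j + 1) = (False, False, True)"
    using tight_steps(1)[of "s (j - 1)" "s (j + 1)" "s (j + 2)"] tight[of j] ends ts
    by (simp add: numeral_eq_Suc)
  show c2: "s (j + 2) = (True, False, True)"
    using tight_steps(2)[of "s (j + 2)" "s (j + 3)"] c1 ends ts by (simp add: numeral_eq_Suc)
  show c3: "s (j + 3) = (True, False, False)"
    using tight_steps(3)[of "s (j + 3)" "s (j + 4)"] c1 c2 ends ts by (simp add: numeral_eq_Suc)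
  show c4: "s (j + 4) = (False, True, True)"
    using tight_steps(4)[of "s (j + 4)" "s (j + 5)"] c2 c3 ts by (simp add: numeral_eq_Suc)
  show c5: "s (j + 5) = (True, False, False)"
    using tight_steps(5)[of "s (j + 5)" "s (j + 6)"] c3 c4 ts by (simp add: numeral_eq_Suc)
  show c6: "s (j + 6) = (True, False, True)"
    using tight_steps(6)[of "s (j + 6)" "s (j + 7)"] c4 c5 ts by (simp add: numeral_eq_Suc)
  show c7: "s (j + 7) = (False, False, True)"
    using tight_steps(7)[of "s (j + 7)" "s (j + 8)"] c5 c6 ts by (simp add: numeral_eq_Suc)
qed

section \<open>From induced matchings to columns\<close>

definition adjacent :: "nat \<times> nat \<Rightarrow> nat \<times> nat \<Rightarrow> bool" where
  "adjacent x y \<longleftrightarrow>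
     fst x = fst y \<and> (snd y = Suc (snd x) \<or> snd x = Suc (snd y)) \<or>
     snd x = snd y \<and> (fst y = Suc (fst x) \<or> fst x = Suc (fst y))"

lemma grid_edge_iff_adjacent:
  "{x, y} \<in> snd (grid n m) \<longleftrightarrow>
     x \<in> {1..n} \<times> {1..m} \<and> y \<in> {1..n} \<times> {1..m} \<and> adjacent x y"
proof -
  have *: "\<bar>int a - int b\<bar> = 1 \<longleftrightarrow> b = Suc a \<or> a = Suc b" for a b by auto
  show ?thesis
    by (cases x; cases y) (simp only: grid_edge_iff grid_verts adjacent_def fst_conv snd_conv *)
qed

lemma grid_edgeE:
  assumes "e \<in> snd (grid n m)" "x \<in> e"
  obtains y where "e = {x, y}"
proof -
  have "\<exists>a b. e = {a, b}"
    using assms(1) unfolding grid_def cartesian_product_def snd_conv by blast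
  then show thesis using assms(2) that by (auto simp: insert_commute)
qed

lemma saturated_grid:
  assumes "induced_matching (grid n m) M" "saturated M x"
  shows "x \<in> {1..n} \<times> {1..m}"
proof -
  obtain e where e: "e \<in> M" "x \<in> e" using assms(2) by (auto simp: saturated_def)
  then have "e \<in> snd (grid n m)" using assms(1) by (auto simp: induced_matching_def)
  moreover from this e(2) obtain y where "e = {x, y}" by (rule grid_edgeE)
  ultimately show ?thesis by (simp add: grid_edge_iff_adjacent)
qed

text \<open>The partner of \<open>x\<close> is the only candidate: an edge of \<open>M\<close> at
  any other saturated neighbour would be joined to the edge of \<open>x\<close> by a grid
  edge.\<close>

lemma saturated_unique_neighbour:
  assumes M: "induced_matching (grid n m) M" and x: "saturated M x"
  obtains y where "adjacent x y" "saturated M y"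
    "\<And>z. adjacent x z \<Longrightarrow> saturated M z \<Longrightarrow> z = y"
proof -
  obtain e where e: "e \<in> M" "x \<in> e" using x by (auto simp: saturated_def)
  then have E: "e \<in> snd (grid n m)" using M by (auto simp: induced_matching_def)
  from this e(2) obtain y where y: "e = {x, y}" by (rule grid_edgeE)
  show thesis
  proof
    show "adjacent x y" using E y by (simp add: grid_edge_iff_adjacent)
    show "saturated M y" using e y by (auto simp: saturated_def)
    fix z assume z: "adjacent x z" "saturated M z"
    then obtain f where f: "f \<in> M" "z \<in> f" by (auto simp: saturated_def)
    have "{x, z} \<in> snd (grid n m)"
      using z saturated_grid[OF M] x by (simp add: grid_edge_iff_adjacent)
    then have "f = e" using M e f unfolding induced_matching_def by blast
    moreover have "x \<noteq> z" using z by (auto simp: adjacent_def)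
    ultimately show "z = y" using f y by auto
  qed
qed

definition column_of :: "(nat \<times> nat) set set \<Rightarrow> nat \<Rightarrow> column" where
  "column_of M i = (saturated M (1, i), saturated M (2, i), saturated M (3, i))"

lemma valid_column_of:
  assumes M: "induced_matching (grid 3 m) M" and i: "1 \<le> i"
  shows "valid (column_of M (i - 1)) (column_of M i) (column_of M (i + 1))"
proof -
  have nbr: "of_bool (saturated M (r, i - 1)) + of_bool (saturated M (r, i + 1)) +
      of_bool (saturated M (r - 1, i)) + of_bool (saturated M (r + 1, i)) = (1::nat)"
    if r: "saturated M (r, i)" "1 \<le> r" for r
  proof -
    let ?N = "{(r, i - 1), (r, i + 1), (r - 1, i), (r + 1, i)}"
    obtain y where y: "adjacent (r, i) y" "saturated M y"
      "\<And>z. adjacent (r, i) z \<Longrightarrow> saturated M z \<Longrightarrow> z = y"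
      using saturated_unique_neighbour[OF M r(1)] by metis
    \<comment> \<open>Since \<open>r\<close> and \<open>i\<close> are positive, truncated
      subtraction yields genuine neighbours.\<close>
    have "adjacent (r, i) z \<longleftrightarrow> z \<in> ?N" for z
      using r(2) i by (cases z) (auto simp: adjacent_def)
    with y have "?N \<inter> {z. saturated M z} = {y}" by blast
    then have "(\<Sum>z\<in>?N. of_bool (saturated M z)) = (1::nat)"
      by (simp only: of_bool_def sum.If_cases finite.intros) simp
    then show ?thesis using r(2) i by (simp del: sum_of_bool_eq)
  qed
  \<comment> \<open>Rows 0 and 4 stand in for the missing neighbours of the outer rows and
    contribute 0.\<close>
  have out: "\<not> saturated M (0, i)" "\<not> saturated M (4, i)"
    using saturated_grid[OF M] by fastforce+
  show ?thesis
    using nbr[of 1] nbr[of 2] nbr[of 3] out by (simp add: column_of_def numeral_eq_Suc)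
qed

text \<open>Double counting of the saturated vertices: by disjoint edges with two vertices each, and
  by columns.\<close>

lemma sum_weight_column_of:
  assumes M: "induced_matching (grid 3 m) M" and fin: "finite M"
  shows "(\<Sum>i\<in>{1..m}. weight (column_of M i)) = 2 * int (card M)"
proof -
  have sub: "\<Union>M \<subseteq> {1..3} \<times> {1..m}"
    using saturated_grid[OF M] by (fastforce simp: saturated_def)
  have card2: "card e = 2" if "e \<in> M" for e
  proof -
    have E: "e \<in> snd (grid 3 m)" using that M by (auto simp: induced_matching_def)
    then have "e \<noteq> {}" by (auto simp: grid_def cartesian_product_def)
    then obtain x y where "e = {x, y}" using grid_edgeE[OF E] by blast
    moreover from this E have "x \<noteq> y"
      by (auto simp: grid_edge_iff_adjacent adjacent_def)
    ultimately show ?thesis by simp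
  qed
  have "card (\<Union>M) = sum card M"
    using M card2 by (intro card_Union_disjoint)
      (auto simp: induced_matching_def pairwise_def disjnt_def intro: card_ge_0_finite)
  then have "2 * int (card M) = int (card (\<Union>M))" using card2 by simp
  also have "\<dots> = (\<Sum>x\<in>{1..3} \<times> {1..m}. of_bool (x \<in> \<Union>M))"
    using sub by (simp add: of_bool_def sum.If_cases Int_absorb1 flip: Union_iff)
  also have "\<dots> = (\<Sum>r\<in>{1..3}. \<Sum>i\<in>{1..m}. of_bool ((r, i) \<in> \<Union>M))"
    by (simp only: sum.cartesian_product) (simp add: case_prod_unfold)
  also have "\<dots> = (\<Sum>i\<in>{1..m}. \<Sum>r\<in>{1..3}. of_bool ((r, i) \<in> \<Union>M))"
    by (rule sum.swap)
  also have "\<dots> = (\<Sum>i\<in>{1..m}. weight (column_of M i))"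
    by (rule sum.cong)
      (auto simp: column_of_def saturated_def Bex_def numeral_eq_Suc sum.atLeast_Suc_atMost)
  finally show ?thesis ..
qed

section \<open>A large periodic matching\<close>

text \<open>
  The periodic matching uses one vertical and two horizontal edges (\<open>d = 0, 1, 2\<close>) in each block
  of four columns, with the first and third rows exchanged in every other block.
\<close>

definition pattern_block :: "bool \<Rightarrow> nat \<Rightarrow> (nat \<times> nat) set" where
  "pattern_block b d =
     (let p = (if b then 3 else 1); q = (if b then 1 else 3) in
      if d = 0 then {(2, 1), (q, 1)} else if d = 1 then {(p, 2), (p, 3)} else {(q, 3), (q, 4)})"

fun pattern_edge :: "nat \<times> nat \<Rightarrow> (nat \<times> nat) set" where
  "pattern_edge (t, d) = (\<lambda>(r, c). (r, 4 * t + c)) ` pattern_block (even t) d"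

text \<open>These are \<open>k\<close> full blocks and the vertical edge of block \<open>k\<close>,
  which lies in the last column \<open>4 * k + 1\<close>.\<close>

definition pattern_index :: "nat \<Rightarrow> (nat \<times> nat) set" where
  "pattern_index k = {..k} \<times> {0} \<union> {..<k} \<times> {1, 2}"

lemma pattern_block_separated:
  "\<forall>d\<in>{0, 1, 2}. \<forall>d'\<in>{0, 1, 2}. d \<noteq> d' \<longrightarrow>
     (\<forall>x\<in>pattern_block b d. \<forall>y\<in>pattern_block b d'. x \<noteq> y \<and> \<not> adjacent x y)"
  by (cases b) (simp_all add: pattern_block_def adjacent_def)

text \<open>A block against its exchanged successor, shifted by 4; the strict inequality of columns
  provides disjointness.\<close>

lemma pattern_block_separated_next:
  "\<forall>d\<in>{0, 1, 2}. \<forall>d'\<in>{0, 1, 2}.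
     \<forall>(r, c)\<in>pattern_block b d. \<forall>(r', c')\<in>pattern_block (\<not> b) d'.
       c < c' + 4 \<and> \<not> adjacent (r, c) (r', c' + 4)"
  by (cases b) (simp_all add: pattern_block_def adjacent_def)

lemma pattern_block_columns: "(r, c) \<in> pattern_block b d \<Longrightarrow> c \<in> {1..4}"
  by (auto simp: pattern_block_def Let_def split: if_splits)

lemma pattern_edge_separated:
  assumes "a \<in> pattern_index k" "b \<in> pattern_index k" "a \<noteq> b"
    and "x \<in> pattern_edge a" "y \<in> pattern_edge b"
  shows "x \<noteq> y \<and> \<not> adjacent x y"
proof -
  obtain t d t' d' where ab: "a = (t, d)" "b = (t', d')" by (cases a; cases b)
  have d: "d \<in> {0, 1, 2}" "d' \<in> {0, 1, 2}"
    using assms(1,2) ab by (auto simp: pattern_index_def)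
  obtain r c where x: "x = (r, 4 * t + c)" "(r, c) \<in> pattern_block (even t) d"
    using assms(4) ab by auto
  obtain r' c' where y: "y = (r', 4 * t' + c')" "(r', c') \<in> pattern_block (even t') d'"
    using assms(5) ab by auto
  note cc = pattern_block_columns[OF x(2)] pattern_block_columns[OF y(2)]
  \<comment> \<open>Only equal or consecutive blocks need the block lemmas; otherwise the columns
    are at least 5 apart.\<close>
  consider "t' = t" | "t' = Suc t" | "t = Suc t'" | "t + 1 < t'" | "t' + 1 < t" by linarith
  then show ?thesis
  proof cases
    case 1
    then have "d \<noteq> d'" using assms(3) ab by simp
    then have "(r, c) \<noteq> (r', c')" "\<not> adjacent (r, c) (r', c')"
      using 1 d x(2) y(2) pattern_block_separated by blast+
    then show ?thesis using 1 x y by (auto simp: adjacent_def)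
  next
    case 2
    then have "c < c' + 4 \<and> \<not> adjacent (r, c) (r', c' + 4)"
      using d x(2) y(2) pattern_block_separated_next[of "even t"] by fastforce
    then show ?thesis using 2 x y by (auto simp: adjacent_def)
  next
    case 3
    then have "c' < c + 4 \<and> \<not> adjacent (r', c') (r, c + 4)"
      using d x(2) y(2) pattern_block_separated_next[of "even t'"] by fastforce
    then show ?thesis using 3 x y by (auto simp: adjacent_def)
  qed (use x y cc in \<open>auto simp: adjacent_def\<close>)
qed

lemma induced_matching_pattern:
  assumes "m = 4 * k + 1"
  shows "induced_matching (grid 3 m) (pattern_edge ` pattern_index k)"
  unfolding induced_matching_def
proof (intro conjI ballI impI)
  show "pattern_edge ` pattern_index k \<subseteq> snd (grid 3 m)"
    using assms
    by (auto simp: pattern_index_def pattern_block_def Let_def grid_edge_iff_adjacent adjacent_def)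
next
  fix e f assume "e \<in> pattern_edge ` pattern_index k" "f \<in> pattern_edge ` pattern_index k" "e \<noteq> f"
  then have "x \<noteq> y \<and> \<not> adjacent x y" if "x \<in> e" "y \<in> f" for x y
    using that pattern_edge_separated by blast
  then show "e \<inter> f = {}" "\<not> (\<exists>x\<in>e. \<exists>y\<in>f. {x, y} \<in> snd (grid 3 m))"
    unfolding grid_edge_iff_adjacent by blast+
qed

lemma card_pattern: "card (pattern_edge ` pattern_index k) = 3 * k + 1"
proof -
  \<comment> \<open>Distinct indices with the same edge would make a nonempty set disjoint from
    itself.\<close>
  have "inj_on pattern_edge (pattern_index k)"
  proof (rule inj_onI, rule ccontr)
    fix a b assume *: "a \<in> pattern_index k" "b \<in> pattern_index k"
      "pattern_edge a = pattern_edge b" "a \<noteq> b"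
    moreover have "pattern_edge a \<noteq> {}"
      by (cases a) (simp add: pattern_block_def Let_def)
    ultimately show False using pattern_edge_separated[of a k b] by blast
  qed
  moreover have "card (pattern_index k) = 3 * k + 1"
    unfolding pattern_index_def by (subst card_Un_disjoint) (auto simp: card_cartesian_product)
  ultimately show ?thesis by (simp add: card_image)
qed

section \<open>The window in a maximum induced matching\<close>

theorem theorem3p8:
  fixes m j :: nat and M :: "(nat \<times> nat) set set"
  assumes "m \<ge> 2"
    and "m mod 4 = 1"
    and "maximum_induced_matching (grid 3 m) M"
    and "1 \<le> j" and "j + 8 \<le> m"
    and "{(1, j), (2, j)} \<in> M"
    and "{(1, j + 8), (2, j + 8)} \<in> M"
  shows "card {k \<in> {j + 1..j + 7}. saturated M (1, k)} \<ge> 4 \<and>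
         card {k \<in> {j + 1..j + 7}. saturated M (2, k)} \<le> 1 \<and>
         card {k \<in> {j..j + 8}. saturated M (3, k)} \<le> 5"
proof -
  have M: "induced_matching (grid 3 m) M" "finite M"
    using assms(3) by (auto simp: maximum_induced_matching_def)
  define s where "s = column_of M"
  have valid: "valid (s (i - 1)) (s i) (s (i + 1))" if "i \<in> {1..m}" for i
    unfolding s_def using that by (intro valid_column_of[OF M(1)]) auto
  obtain k where k: "m = 4 * k + 1"
    using assms(2) by (metis mult_div_mod_eq)
  have "3 * k + 1 \<le> card M"
    using assms(3) induced_matching_pattern[OF k] card_pattern[of k]
    unfolding maximum_induced_matching_def by metis
  \<comment> \<open>The total excess is \<open>2 * (2 * card M) - 3 * m\<close>, hence at least
    \<open>4 * (3 * k + 1) - 3 * (4 * k + 1) = 1\<close>.\<close>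
  then have pos: "(\<Sum>i\<in>{1..m}. excess (s i)) \<ge> 1"
    using sum_weight_column_of[OF M] k
    by (simp add: s_def sum_subtractf flip: sum_distrib_left)
  \<comment> \<open>The third entry is false because the middle vertex already has its one saturated
    neighbour.\<close>
  have vertical: "s i = (True, True, False)" if "{(1, i), (2, i)} \<in> M" "i \<in> {1..m}" for i
  proof -
    have "saturated M (1, i)" "saturated M (2, i)" using that(1) by (auto simp: saturated_def)
    with valid[OF that(2)] show ?thesis
      by (auto simp: s_def column_of_def of_bool_def split: if_splits)
  qed
  have ends: "s j = (True, True, False)" "s (j + 8) = (True, True, False)"
    using vertical assms(4-7) by auto
  note cols = ends window_columns[OF valid assms(4,5) ends pos]
  have J: "{j + 1..j + 7} = {j + 1, j + 2, j + 3, j + 4, j + 5, j + 6, j + 7}"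
    "{j..j + 8} = insert j (insert (j + 8) {j + 1..j + 7})"
    by auto
  have "{k \<in> {j + 1..j + 7}. saturated M (1, k)} = {j + 2, j + 3, j + 5, j + 6}"
    "{k \<in> {j + 1..j + 7}. saturated M (2, k)} = {j + 4}"
    "{k \<in> {j..j + 8}. saturated M (3, k)} = {j + 1, j + 2, j + 4, j + 6, j + 7}"
    using cols unfolding J by (auto simp: s_def column_of_def)
  then show ?thesis by simp
qed

end
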